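(* Let $G$ be a finite simple connected graph and let $x,y$ be two distinct vertices of $G$ such that $xy\notin E(G)$. If $G$ is upper-critical, then the graph $G/x,y$ obtained by identifying $x$ and $y$ is also upper-critical.
   Context: For two non-adjacent vertices $x,y$ of $G$, the vertex identification $G/x,y$ is the graph obtained by replacing $x$ and $y$ by a single new vertex $z$ with $N(z)=N(x)\cup N(y)$, where $N(v)$ denotes the set of vertices adjacent to $v$. $\chi(G)$ is the chromatic number. $\overline{G}$ is the complement of $G$, and for $e\in E(\overline{G})$, $G+e$ is $G$ with the edge $e$ added. A graph $G$ is upper-critical if no edge can be added to it while preserving its chromatic number, i.e. $\{e\in E(\overline{G}) : \chi(G+e)=\chi(G)\}=\emptyset$ (equivalently, $\chi(G+e)>\chi(G)$ for all $e\in E(\overline{G})$; in particular every complete graph is upper-critical). *)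

theory Defs
  imports "Graph_Theory.Digraph_Component"
begin

text \<open>
  A finite simple graph is a \<open>pair_graph\<close>: an edge \<open>uv\<close> is the pair of opposite
  arcs \<open>(u, v)\<close>, \<open>(v, u)\<close>.
\<close>

definition nbhd :: "'a pair_pre_digraph \<Rightarrow> 'a \<Rightarrow> 'a set" where
  "nbhd G v = {u. (v, u) \<in> parcs G}"

definition complement :: "'a pair_pre_digraph \<Rightarrow> 'a pair_pre_digraph" where
  "complement G =
     \<lparr> pverts = pverts G,
       parcs = {(u, v). u \<in> pverts G \<and> v \<in> pverts G \<and> u \<noteq> v \<and> (u, v) \<notin> parcs G} \<rparr>"

definition add_edge :: "'a pair_pre_digraph \<Rightarrow> 'a \<times> 'a \<Rightarrow> 'a pair_pre_digraph" where
  "add_edge G e = G\<lparr> parcs := parcs G \<union> {(fst e, snd e), (snd e, fst e)} \<rparr>"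

definition proper_colouring :: "'a pair_pre_digraph \<Rightarrow> nat \<Rightarrow> ('a \<Rightarrow> nat) \<Rightarrow> bool" where
  "proper_colouring G k c \<longleftrightarrow>
     (\<forall>v \<in> pverts G. c v < k) \<and> (\<forall>(u, v) \<in> parcs G. c u \<noteq> c v)"

definition chromatic_number :: "'a pair_pre_digraph \<Rightarrow> nat" where
  "chromatic_number G = (LEAST k. \<exists>c. proper_colouring G k c)"

definition upper_critical :: "'a pair_pre_digraph \<Rightarrow> bool" where
  "upper_critical G \<longleftrightarrow>
     {e \<in> parcs (complement G). chromatic_number (add_edge G e) = chromatic_number G} = {}"

text \<open>
  In the identification of \<open>x\<close> and \<open>y\<close> the new vertex is \<open>None\<close>; the remaining
  vertices \<open>v\<close> of \<open>G\<close> become \<open>Some v\<close>.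
\<close>

definition identify :: "'a pair_pre_digraph \<Rightarrow> 'a \<Rightarrow> 'a \<Rightarrow> 'a option pair_pre_digraph" where
  "identify G x y =
     \<lparr> pverts = insert None (Some ` (pverts G - {x, y})),
       parcs = {(Some u, Some v) | u v. (u, v) \<in> parcs G \<and> u \<notin> {x, y} \<and> v \<notin> {x, y}}
             \<union> {(None, Some v) | v. v \<in> nbhd G x \<union> nbhd G y}
             \<union> {(Some v, None) | v. v \<in> nbhd G x \<union> nbhd G y} \<rparr>"

lemma pair_graph_iff:
  "pair_graph G \<longleftrightarrow> finite (pverts G) \<and> parcs G \<subseteq> pverts G \<times> pverts G
     \<and> sym (parcs G) \<and> irrefl (parcs G)"
proof
  assume "pair_graph G"
  then interpret pair_graph G .
  show "finite (pverts G) \<and> parcs G \<subseteq> pverts G \<times> pverts G \<and> sym (parcs G) \<and> irrefl (parcs G)"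
    using pair_finite_verts pair_sym_arcs pair_no_loops wellformed'
    by (force simp: symmetric_def irrefl_def)
next
  assume *: "finite (pverts G) \<and> parcs G \<subseteq> pverts G \<times> pverts G
    \<and> sym (parcs G) \<and> irrefl (parcs G)"
  then have "finite (parcs G)"
    by (meson finite_SigmaI finite_subset)
  with * show "pair_graph G"
    by unfold_locales (auto simp: symmetric_def irrefl_def)
qed

lemma pair_graph_complement: "pair_graph G \<Longrightarrow> pair_graph (complement G)"
  by (auto simp: pair_graph_iff complement_def sym_def irrefl_def)

lemma pair_graph_add_edge:
  "pair_graph G \<Longrightarrow> e \<in> parcs (complement G) \<Longrightarrow> pair_graph (add_edge G e)"
  by (auto simp: pair_graph_iff complement_def add_edge_def sym_def irrefl_def)

lemma pair_graph_identify:
  assumes "pair_graph G" "(x, y) \<notin> parcs G"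
  shows "pair_graph (identify G x y)"
proof -
  have "(y, x) \<notin> parcs G" using assms by (auto simp: pair_graph_iff sym_def)
  with assms show ?thesis
    by (auto simp: pair_graph_iff identify_def nbhd_def sym_def irrefl_def)
qed

lemma nbhd_identify_None: "nbhd (identify G x y) None = Some ` (nbhd G x \<union> nbhd G y)"
  by (auto simp: nbhd_def identify_def)

lemma chromatic_number_attained:
  assumes "pair_graph G"
  shows "\<exists>c. proper_colouring G (chromatic_number G) c"
proof -
  from assms obtain f :: "'a \<Rightarrow> nat" and n where f: "f ` pverts G = {i. i < n}" "inj_on f (pverts G)"
    using finite_imp_inj_to_nat_seg by (metis pair_graph_iff)
  with assms have "proper_colouring G n f"
    by (fastforce simp: proper_colouring_def pair_graph_iff irrefl_def inj_on_def)
  then have "\<exists>k c. proper_colouring G k c" by blast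
  then show ?thesis unfolding chromatic_number_def by (rule LeastI_ex)
qed

end

theory Submission
  imports Defs
begin

text \<open>
  For non-adjacent \<open>x\<close> and \<open>y\<close>, proper colourings of \<open>identify G x y\<close> correspond to proper
  colourings of \<open>G\<close> that give \<open>x\<close> and \<open>y\<close> one colour, by composing with the identification map and with a section of it
  (\<open>proper_colouring_merge\<close>, \<open>proper_colouring_identify\<close>). In an upper-critical graph every
  optimal colouring gives non-adjacent vertices one colour, since otherwise it would remain proper
  after joining them (\<open>upper_critical_nonadjacent_same_colour\<close>). Hence an optimal colouring of
  \<open>G\<close> descends, and \<open>\<chi>(identify G x y) \<le> \<chi>(G)\<close>.

  Suppose now that an edge \<open>e\<close> could be added to \<open>identify G x y\<close> with its chromatic number
  unchanged. The non-adjacent pair \<open>e\<close> lifts to a non-adjacent pair \<open>e'\<close> of \<open>G\<close>, and an optimal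
  colouring of \<open>identify G x y + e\<close> pulls back to a colouring of \<open>G\<close> with at most \<open>\<chi>(G)\<close> colours,
  hence an optimal one, that separates the ends of \<open>e'\<close>. This is impossible because \<open>G\<close> is
  upper-critical.
\<close>

lemma chromatic_number_le:
  "proper_colouring G k c \<Longrightarrow> chromatic_number G \<le> k"
  unfolding chromatic_number_def by (rule Least_le) blast

lemma proper_colouring_add_edge_iff:
  "proper_colouring (add_edge G (u, v)) k c \<longleftrightarrow> proper_colouring G k c \<and> c u \<noteq> c v"
  by (auto simp: proper_colouring_def add_edge_def)

lemma chromatic_number_le_add_edge:
  assumes "pair_graph G" "(u, v) \<in> parcs (complement G)"
  shows "chromatic_number G \<le> chromatic_number (add_edge G (u, v))"
  using chromatic_number_attained[OF pair_graph_add_edge[OF assms]]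
  by (auto simp: proper_colouring_add_edge_iff intro: chromatic_number_le)

text \<open>
  An optimal colouring that separated \<open>u\<close> and \<open>v\<close> would also be proper after the edge \<open>uv\<close> is
  added, so that this edge would leave the chromatic number unchanged.
\<close>

lemma upper_critical_nonadjacent_same_colour:
  assumes "pair_graph G" "upper_critical G"
    and uv: "(u, v) \<in> parcs (complement G)"
    and c: "proper_colouring G (chromatic_number G) c"
  shows "c u = c v"
proof (rule ccontr)
  assume "c u \<noteq> c v"
  with c have "chromatic_number (add_edge G (u, v)) \<le> chromatic_number G"
    by (intro chromatic_number_le) (simp add: proper_colouring_add_edge_iff)
  with chromatic_number_le_add_edge[OF assms(1) uv]
  have "chromatic_number (add_edge G (u, v)) = chromatic_number G" by simp
  with uv \<open>upper_critical G\<close> show False by (auto simp: upper_critical_def)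
qed

definition merge :: "'a \<Rightarrow> 'a \<Rightarrow> 'a \<Rightarrow> 'a option" where
  "merge x y v = (if v \<in> {x, y} then None else Some v)"

text \<open>
  The map \<open>case_option x id\<close> is a section of \<open>merge x y\<close> on the vertices of \<open>identify G x y\<close>: it
  represents the new vertex by \<open>x\<close>.
\<close>

lemma merge_section:
  "w \<in> pverts (identify G x y) \<Longrightarrow> merge x y (case_option x id w) = w"
  by (auto simp: identify_def merge_def)

lemma proper_colouring_merge:
  assumes "pair_graph G" "(x, y) \<notin> parcs G"
    and d: "proper_colouring (identify G x y) k d"
  shows "proper_colouring G k (d \<circ> merge x y)"
proof -
  have "merge x y v \<in> pverts (identify G x y)" if "v \<in> pverts G" for v
    using that by (auto simp: merge_def identify_def)
  moreover have "(merge x y u, merge x y v) \<in> parcs (identify G x y)" if "(u, v) \<in> parcs G" for u v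
  proof -
    have "(v, u) \<in> parcs G" "(y, x) \<notin> parcs G" "u \<noteq> v" "(x, x) \<notin> parcs G" "(y, y) \<notin> parcs G"
      using assms that by (auto simp: pair_graph_iff sym_def irrefl_def)
    with that \<open>(x, y) \<notin> parcs G\<close> show ?thesis
      by (auto simp: merge_def identify_def nbhd_def)
  qed
  ultimately show ?thesis
    using d by (fastforce simp: proper_colouring_def)
qed

lemma proper_colouring_identify:
  assumes "pair_graph G" "x \<in> pverts G"
    and c: "proper_colouring G k c" "c x = c y"
  shows "proper_colouring (identify G x y) k (c \<circ> case_option x id)"
proof -
  have "c u \<noteq> c v \<and> c v \<noteq> c u" if "(u, v) \<in> parcs G" for u v
    using that c by (fastforce simp: proper_colouring_def)
  \<comment> \<open>An edge at the new vertex may stem from \<open>y\<close> instead of its representative \<open>x\<close>.\<close>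
  then have "c x \<noteq> c v \<and> c v \<noteq> c x" if "v \<in> nbhd G x \<union> nbhd G y" for v
    using that c(2) by (fastforce simp: nbhd_def)
  with c \<open>x \<in> pverts G\<close> show ?thesis
    by (fastforce simp: proper_colouring_def identify_def)
qed

lemma complement_identify_section:
  assumes "x \<in> pverts G" "(w, z) \<in> parcs (complement (identify G x y))"
    and "pair_graph G"
  shows "(case_option x id w, case_option x id z) \<in> parcs (complement G)"
  using assms
  by (auto simp: complement_def identify_def nbhd_def pair_graph_iff sym_def)

theorem theorem7:
  fixes G :: "'a pair_pre_digraph" and x y :: 'a
  assumes "pair_graph G" and "Digraph_Component.connected G"
    and "x \<in> pverts G" and "y \<in> pverts G" and "x \<noteq> y"
    and "(x, y) \<notin> parcs G"
    and "upper_critical G"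
  shows "upper_critical (identify G x y)"
proof -
  let ?H = "identify G x y" and ?s = "case_option x id"
  have H: "pair_graph ?H" using assms(1,6) by (rule pair_graph_identify)
  have xy: "(x, y) \<in> parcs (complement G)" using assms by (simp add: complement_def)

  obtain c where c: "proper_colouring G (chromatic_number G) c"
    using chromatic_number_attained[OF assms(1)] by blast
  have "c x = c y"
    using upper_critical_nonadjacent_same_colour[OF assms(1,7) xy c] .
  with assms(1,3) c have "proper_colouring ?H (chromatic_number G) (c \<circ> ?s)"
    by (intro proper_colouring_identify)
  then have le: "chromatic_number ?H \<le> chromatic_number G" by (rule chromatic_number_le)

  have "chromatic_number (add_edge ?H (w, z)) \<noteq> chromatic_number ?H"
    if wz: "(w, z) \<in> parcs (complement ?H)" for w z
  proof
    assume eq: "chromatic_number (add_edge ?H (w, z)) = chromatic_number ?H"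
    obtain d where d: "proper_colouring ?H (chromatic_number ?H) d" "d w \<noteq> d z"
      using chromatic_number_attained[OF pair_graph_add_edge[OF H wz]]
      by (auto simp: eq proper_colouring_add_edge_iff)
    let ?d = "d \<circ> merge x y"
    have lift: "proper_colouring G (chromatic_number ?H) ?d"
      using assms(1,6) d(1) by (rule proper_colouring_merge)
    with le have "chromatic_number ?H = chromatic_number G"
      using chromatic_number_le[OF lift] by simp
    with lift have "proper_colouring G (chromatic_number G) ?d" by simp
    then have "?d (?s w) = ?d (?s z)"
      using upper_critical_nonadjacent_same_colour[OF assms(1,7)]
        complement_identify_section[OF assms(3) wz assms(1)] by blast
    moreover have "w \<in> pverts ?H" "z \<in> pverts ?H" using wz by (auto simp: complement_def)
    ultimately have "d w = d z" by (simp add: merge_section)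
    with d(2) show False by contradiction
  qed
  then show ?thesis by (auto simp: upper_critical_def)
qed

end
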